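(* Let $H$ be a right Hilbert module over a $C^*$-algebra and let $Q\in\mathcal{L}(H)$ be an idempotent. Then $$m(Q)=\frac{2I+|Q+Q^*|-|2I-(Q+Q^* )|}{4}.$$
   Context: $\mathcal{L}(H)$ denotes the $C^*$-algebra of all adjointable operators on $H$, $I$ is the identity operator on $H$, $T^*$ is the adjoint of $T$, and $|T|=(T^*T)^{1/2}$ is the positive square root. $Q$ is an idempotent if $Q^2=Q$, and a projection if moreover $Q^*=Q$. For $T\in\mathcal{L}(H)$ with closed range, $T^\dagger$ denotes its Moore–Penrose inverse (the unique $X\in\mathcal{L}(H)$ with $TXT=T$, $XTX=X$, $(TX)^*=TX$, $(XT)^*=XT$). The matched projection of an idempotent $Q\in\mathcal{L}(H)$ is defined by $$m(Q)=\tfrac12\big(|Q^*|+Q^*\big)|Q^*|^\dagger\big(|Q^*|+I\big)^{-1}\big(|Q^*|+Q\big)$$ (here $|Q^*|$ has closed range, so $|Q^*|^\dagger$ exists); it is a projection. *)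

theory Defs
  imports "HOL-Analysis.Analysis"
begin

text \<open>A unital C*-algebra: a (nonzero) complex Banach algebra with unit, given by the
  underlying real Banach algebra structure of the type, a complex scalar multiplication sc
  extending scaleR, and an involution st satisfying the C*-identity.
  The algebra of adjointable operators on a Hilbert C*-module is such an algebra, and
  conversely every unital C*-algebra A is the algebra of adjointable operators on A_A.\<close>

definition cstar_alg :: "(complex \<Rightarrow> 'a::{banach,real_normed_algebra_1} \<Rightarrow> 'a) \<Rightarrow> ('a \<Rightarrow> 'a) \<Rightarrow> bool"
  where "cstar_alg sc st \<longleftrightarrow>
    (\<forall>r x. sc (complex_of_real r) x = (r::real) *\<^sub>R x) \<and>
    (\<forall>a b x. sc (a + b) x = sc a x + sc b x) \<and>
    (\<forall>a x y. sc a (x + y) = sc a x + sc a y) \<and>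
    (\<forall>a b x. sc a (sc b x) = sc (a * b) x) \<and>
    (\<forall>x. sc 1 x = x) \<and>
    (\<forall>a x. norm (sc a x) = cmod a * norm x) \<and>
    (\<forall>a x y. sc a x * y = sc a (x * y)) \<and>
    (\<forall>a x y. x * sc a y = sc a (x * y)) \<and>
    (\<forall>x y. st (x + y) = st x + st y) \<and>
    (\<forall>a x. st (sc a x) = sc (cnj a) (st x)) \<and>
    (\<forall>x y. st (x * y) = st y * st x) \<and>
    (\<forall>x. st (st x) = x) \<and>
    (\<forall>x. norm (st x * x) = (norm x)\<^sup>2)"

definition cpositive :: "('a::real_normed_algebra_1 \<Rightarrow> 'a) \<Rightarrow> 'a \<Rightarrow> bool"
  where "cpositive st x \<longleftrightarrow> (\<exists>y. x = st y * y)"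

definition cabs :: "('a::real_normed_algebra_1 \<Rightarrow> 'a) \<Rightarrow> 'a \<Rightarrow> 'a"
  where "cabs st T = (THE S. cpositive st S \<and> S * S = st T * T)"

definition cinv :: "'a::real_normed_algebra_1 \<Rightarrow> 'a"
  where "cinv x = (THE y. x * y = 1 \<and> y * x = 1)"

definition mp_inv :: "('a::real_normed_algebra_1 \<Rightarrow> 'a) \<Rightarrow> 'a \<Rightarrow> 'a"
  where "mp_inv st T = (THE X. T * X * T = T \<and> X * T * X = X \<and>
                               st (T * X) = T * X \<and> st (X * T) = X * T)"

definition matched_proj :: "('a::real_normed_algebra_1 \<Rightarrow> 'a) \<Rightarrow> 'a \<Rightarrow> 'a"
  where "matched_proj st Q =
    (1/2::real) *\<^sub>R ((cabs st (st Q) + st Q) * mp_inv st (cabs st (st Q))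
                    * cinv (cabs st (st Q) + 1) * (cabs st (st Q) + Q))"

end

theory Submission
  imports Defs
begin

text \<open>The element \<open>S = Q + Q* - 1\<close> is self-adjoint, \<open>S^2 = 1 + (Q - Q* )* (Q - Q* )\<close> is invertible and
  commutes with \<open>Q\<close> because \<open>Q S^2 = Q Q* Q = S^2 Q\<close>. Hence \<open>W = |S|\<close> commutes with \<open>Q\<close> and \<open>Q*\<close>,
  \<open>W \<ge> 1\<close>, and \<open>V = S W^-1\<close> is a symmetry. This gives \<open>|Q + Q*| = |1 + S| = W + V\<close> and
  \<open>|2 - (Q + Q* )| = |1 - S| = W - V\<close>, so the right-hand side is \<open>(1 + V) / 2\<close>. On the other hand
  \<open>P = Q Q* W^-2\<close> is the range projection of \<open>Q\<close>, \<open>|Q*| = W P\<close>, its Moore-Penrose inverse is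
  \<open>W^-1 P\<close>, and the matched projection becomes a rational expression in \<open>W\<close>, \<open>Q\<close> and \<open>Q*\<close>.

  Moduli are identified by uniqueness of positive square roots. This is proved without spectral
  theory, from a norm characterisation of positivity and the vanishing of \<open>x\<close> whenever
  \<open>x* x = - c^2\<close> with \<open>c\<close> self-adjoint.\<close>

section \<open>Two-sided inverses in Banach algebras\<close>

lemma neumann_inverse:
  fixes u :: "'a::{banach,real_normed_algebra_1}"
  assumes "norm u < 1"
  obtains k where "(1 - u) * k = 1" "k * (1 - u) = 1"
proof
  let ?k = "\<Sum>n. u ^ n"
  have s: "summable (\<lambda>n. u ^ n)"
    by (rule summable_comparison_test'[of "\<lambda>n. norm u ^ n" 0])
      (use assms in \<open>auto simp: norm_power_ineq\<close>)
  have h: "?k = 1 + (\<Sum>n. u ^ Suc n)"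
    using suminf_split_head[OF s] by simp
  have "u * ?k = (\<Sum>n. u ^ Suc n)" "?k * u = (\<Sum>n. u ^ Suc n)"
    using suminf_mult[OF s, of u] suminf_mult2[OF s, of u]
    by (simp_all add: power_commutes)
  with h show "(1 - u) * ?k = 1" "?k * (1 - u) = 1"
    by (simp_all add: algebra_simps)
qed

lemma inverse_commute:
  fixes x :: "'a::monoid_mult"
  assumes "a * k = 1" "k * a = 1" "x * a = a * x"
  shows "x * k = k * x"
proof -
  have "x * k = k * (a * x) * k" by (simp add: assms mult.assoc[symmetric])
  also have "\<dots> = k * x * (a * k)" by (simp only: assms(3)[symmetric] mult.assoc)
  finally show ?thesis by (simp add: assms)
qed

lemma cinv_eqI:
  assumes "x * y = 1" "y * x = 1"
  shows "cinv x = y"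
  unfolding cinv_def
proof (rule the_equality)
  fix z assume "x * z = 1 \<and> z * x = 1"
  then have "z * (x * y) = z" "z * x * y = y" using assms by simp_all
  then show "z = y" by (simp add: mult.assoc)
qed (use assms in simp)

section \<open>Square roots by fixed-point iteration\<close>

text \<open>A fixed point \<open>y\<close> satisfies \<open>2 y = u + y^2\<close>, that is
  \<open>(1 - y)^2 = 1 - u\<close>, so the limit yields a square root of
  \<open>1 - u\<close>.\<close>

primrec sqrt_iter :: "'a::real_normed_algebra_1 \<Rightarrow> nat \<Rightarrow> 'a" where
  "sqrt_iter u 0 = 0"
| "sqrt_iter u (Suc n) = (1/2) *\<^sub>R (u + sqrt_iter u n * sqrt_iter u n)"

lemma sqrt_iter_commute:
  assumes "x * u = u * x"
  shows "x * sqrt_iter u n = sqrt_iter u n * x"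
proof (induction n)
  case (Suc n)
  then have "x * (sqrt_iter u n * sqrt_iter u n) = sqrt_iter u n * sqrt_iter u n * x"
    by (metis mult.assoc)
  then show ?case using assms by (simp add: algebra_simps)
qed simp

lemma sqrt_iter_one_bounds: "0 \<le> sqrt_iter (1::real) n \<and> sqrt_iter (1::real) n \<le> 1"
proof (induction n)
  case (Suc n)
  then have "sqrt_iter (1::real) n * sqrt_iter 1 n \<le> 1" by (simp add: mult_le_one)
  then show ?case by simp
qed simp

lemma norm_sqrt_iter_le:
  fixes u :: "'a::real_normed_algebra_1"
  assumes "norm u \<le> 1"
  shows "norm (sqrt_iter u n) \<le> sqrt_iter 1 n"
proof (induction n)
  case (Suc n)
  have "norm (u + sqrt_iter u n * sqrt_iter u n) \<le> 1 + sqrt_iter 1 n * sqrt_iter 1 n"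
    by (intro norm_triangle_mono norm_mult_ineq[THEN order_trans] mult_mono assms Suc)
      (auto simp: sqrt_iter_one_bounds)
  then show ?case by simp
qed simp

text \<open>The scalar iteration with \<open>u = 1\<close> is a majorant: successive iterates
  commute, so the difference of their squares factors and each factor is bounded by its scalar
  counterpart.\<close>

lemma norm_sqrt_iter_diff_le:
  fixes u :: "'a::real_normed_algebra_1"
  assumes "norm u \<le> 1"
  shows "norm (sqrt_iter u (Suc n) - sqrt_iter u n) \<le> sqrt_iter 1 (Suc n) - sqrt_iter 1 n"
proof (induction n)
  case 0
  show ?case using assms by simp
next
  case (Suc n)
  let ?y = "sqrt_iter u" and ?s = "sqrt_iter (1::real)"
  have c: "?y (Suc n) * ?y n = ?y n * ?y (Suc n)"
    by (intro sqrt_iter_commute sqrt_iter_commute[symmetric] refl)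
  have "?y (Suc (Suc n)) - ?y (Suc n) = (1/2) *\<^sub>R (?y (Suc n) * ?y (Suc n) - ?y n * ?y n)"
    by (simp add: algebra_simps)
  also have "?y (Suc n) * ?y (Suc n) - ?y n * ?y n
      = (?y (Suc n) - ?y n) * (?y (Suc n) + ?y n)"
    using c by (simp only: ring_distribs) simp
  also have "norm ((1/2) *\<^sub>R \<dots>) \<le> (1/2) * ((?s (Suc n) - ?s n) * (?s (Suc n) + ?s n))"
    unfolding norm_scaleR
    by (intro mult_mono norm_mult_ineq[THEN order_trans] norm_triangle_mono
        norm_sqrt_iter_le[OF assms] Suc add_nonneg_nonneg mult_nonneg_nonneg)
      (use order_trans[OF norm_ge_zero Suc] in \<open>auto simp: sqrt_iter_one_bounds simp del: sqrt_iter.simps\<close>)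
  also have "\<dots> = ?s (Suc (Suc n)) - ?s (Suc n)"
    by (simp add: algebra_simps)
  finally show ?case .
qed

text \<open>The scalar iterates increase and stay below 1, so their increments are summable; these
  dominate the increments for \<open>u\<close>.\<close>

lemma convergent_sqrt_iter:
  fixes u :: "'a::{banach,real_normed_algebra_1}"
  assumes "norm u \<le> 1"
  shows "convergent (sqrt_iter u)"
proof -
  let ?s = "sqrt_iter (1::real)"
  have "0 \<le> ?s (Suc n) - ?s n" for n
    using order_trans[OF norm_ge_zero norm_sqrt_iter_diff_le[OF assms]] .
  then have "incseq ?s" by (intro incseq_SucI) simp
  then have "convergent ?s"
    using incseq_bounded[of ?s 1] sqrt_iter_one_bounds
    by (auto simp: convergent_def intro: incseq_convergent)
  then have "summable (\<lambda>n. ?s (Suc n) - ?s n)"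
    by (metis convergent_def summable_def telescope_sums)
  then have "summable (\<lambda>n. sqrt_iter u (Suc n) - sqrt_iter u n)"
    by (rule summable_comparison_test') (rule norm_sqrt_iter_diff_le[OF assms])
  then show ?thesis
    by (simp add: summable_iff_convergent sum_lessThan_telescope del: sqrt_iter.simps(2))
qed

section \<open>Arithmetic of the involution and of complex scalars\<close>

locale cstar =
  fixes sc :: "complex \<Rightarrow> 'a::{banach,real_normed_algebra_1} \<Rightarrow> 'a"
    and st :: "'a \<Rightarrow> 'a"
  assumes cstar_alg: "cstar_alg sc st"
begin

lemma sc_of_real: "sc (complex_of_real r) x = r *\<^sub>R x"
  and sc_sc: "sc a (sc b x) = sc (a * b) x"
  and norm_sc: "norm (sc a x) = cmod a * norm x"
  and sc_mult_left: "sc a x * y = sc a (x * y)"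
  and sc_mult_right: "x * sc a y = sc a (x * y)"
  and sc_add_right: "sc a (x + y) = sc a x + sc a y"
  and st_add: "st (x + y) = st x + st y"
  and st_sc: "st (sc a x) = sc (cnj a) (st x)"
  and st_mult: "st (x * y) = st y * st x"
  and st_st [simp]: "st (st x) = x"
  and norm_st_mult_self: "norm (st x * x) = (norm x)\<^sup>2"
  using cstar_alg unfolding cstar_alg_def by metis+

lemma st_scaleR: "st (r *\<^sub>R x) = r *\<^sub>R st x"
  using st_sc[of "of_real r" x] by (simp add: sc_of_real)

lemma st_zero [simp]: "st 0 = 0"
  using st_scaleR[of 0 0] by simp

lemma st_minus: "st (- x) = - st x"
  using st_scaleR[of "-1" x] by simp

lemma st_diff: "st (x - y) = st x - st y"
  using st_add[of x "- y"] by (simp add: st_minus)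

lemma st_one [simp]: "st 1 = 1"
  using st_mult[of "st 1" 1] by simp

lemmas st_simps = st_add st_diff st_minus st_scaleR st_mult

lemma norm_st [simp]: "norm (st x) = norm x"
proof -
  have le: "norm y \<le> norm (st y)" for y
  proof (cases "y = 0")
    case False
    have "norm y * norm y \<le> norm (st y) * norm y"
      using norm_st_mult_self[of y] norm_mult_ineq[of "st y" y] by (simp add: power2_eq_square)
    then show ?thesis using False by simp
  qed simp
  show ?thesis using le[of x] le[of "st x"] by simp
qed

lemma st_mult_self_eq_0: "st x * x = 0 \<Longrightarrow> x = 0"
  using norm_st_mult_self[of x] by simp

lemma square_eq_0: "st x = x \<Longrightarrow> x * x = 0 \<Longrightarrow> x = 0"
  using st_mult_self_eq_0[of x] by simp

lemma isCont_st: "isCont st x"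
  by (rule bounded_linear.isCont[where g = "\<lambda>x. x"])
    (auto intro!: bounded_linear_intro[where K = 1] simp: st_simps)

definition imag :: "'a \<Rightarrow> 'a" where "imag x = sc \<i> x"

lemma imag_add: "imag (x + y) = imag x + imag y"
  and imag_mult_left: "imag x * y = imag (x * y)"
  and imag_mult_right: "x * imag y = imag (x * y)"
  and norm_imag: "norm (imag x) = norm x"
  by (simp_all add: imag_def sc_add_right sc_mult_left sc_mult_right norm_sc)

lemma imag_imag: "imag (imag x) = - x"
  using sc_of_real[of "-1" x] by (simp add: imag_def sc_sc)

lemma imag_scaleR: "imag (r *\<^sub>R x) = r *\<^sub>R imag x"
  by (simp add: imag_def sc_of_real[symmetric] sc_sc mult.commute)

lemma imag_minus: "imag (- x) = - imag x"
  using imag_scaleR[of "-1" x] by simp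

lemma imag_diff: "imag (x - y) = imag x - imag y"
  using imag_add[of x "- y"] by (simp add: imag_minus)

lemma st_imag: "st (imag x) = - imag (st x)"
  using sc_of_real[of "-1" "imag (st x)"] by (simp add: imag_def st_sc sc_sc)

lemmas imag_simps = imag_add imag_diff imag_minus imag_scaleR imag_mult_left imag_mult_right
  imag_imag st_imag

section \<open>Positive elements and their square roots\<close>

text \<open>A norm description of nonnegative spectrum which makes additivity immediate.\<close>
definition pos :: "'a \<Rightarrow> bool" where
  "pos a \<longleftrightarrow> st a = a \<and> (\<exists>t. norm (t *\<^sub>R 1 - a) \<le> t)"

lemma pos_st: "pos a \<Longrightarrow> st a = a"
  by (simp add: pos_def)

lemma pos_add: "pos a \<Longrightarrow> pos b \<Longrightarrow> pos (a + b)"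
proof -
  assume "pos a" "pos b"
  then obtain t s where ts: "norm (t *\<^sub>R 1 - a) \<le> t" "norm (s *\<^sub>R 1 - b) \<le> s"
    and st: "st a = a" "st b = b"
    unfolding pos_def by blast
  from ts have "norm ((t *\<^sub>R 1 - a) + (s *\<^sub>R 1 - b)) \<le> t + s" by (rule norm_triangle_mono)
  then have "norm ((t + s) *\<^sub>R 1 - (a + b)) \<le> t + s" by (simp add: algebra_simps)
  then show ?thesis using st unfolding pos_def by (auto simp: st_simps)
qed

lemma pos_scaleR: "pos a \<Longrightarrow> 0 \<le> r \<Longrightarrow> pos (r *\<^sub>R a)"
proof -
  assume "pos a" "0 \<le> r"
  then obtain t where t: "norm (t *\<^sub>R 1 - a) \<le> t" and st: "st a = a"
    unfolding pos_def by blast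
  have "norm ((r * t) *\<^sub>R 1 - r *\<^sub>R a) = r * norm (t *\<^sub>R 1 - a)"
    using \<open>0 \<le> r\<close> norm_scaleR[of r "t *\<^sub>R 1 - a"] by (simp add: scaleR_diff_right)
  also have "\<dots> \<le> r * t" using t \<open>0 \<le> r\<close> by (rule mult_left_mono)
  finally show ?thesis using st unfolding pos_def by (auto simp: st_simps)
qed

lemma one_minus_sqrt_exists:
  assumes "norm u \<le> 1" "st u = u"
  obtains y where "(1 - y) * (1 - y) = 1 - u" "norm y \<le> 1" "st y = y"
    "\<And>x. x * u = u * x \<Longrightarrow> x * y = y * x"
proof -
  obtain y where lim: "sqrt_iter u \<longlonglongrightarrow> y"
    using convergent_sqrt_iter[OF assms(1)] by (auto simp: convergent_def)
  have "(\<lambda>n. sqrt_iter u (Suc n)) \<longlonglongrightarrow> (1/2) *\<^sub>R (u + y * y)"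
    unfolding sqrt_iter.simps by (intro tendsto_intros lim)
  with LIMSEQ_Suc[OF lim] have y: "y = (1/2) *\<^sub>R (u + y * y)"
    by (rule LIMSEQ_unique)
  have "y + y = u + y * y"
    by (subst (1 2) y) (simp add: scaleR_add_left[symmetric])
  then have sq: "(1 - y) * (1 - y) = 1 - u" by (simp add: algebra_simps)
  have "norm (sqrt_iter u n) \<le> 1" for n
    using norm_sqrt_iter_le[OF assms(1)] sqrt_iter_one_bounds order_trans by blast
  then have ny: "norm y \<le> 1" by (intro LIMSEQ_le_const2[OF tendsto_norm[OF lim]]) auto
  have "st (sqrt_iter u n) = sqrt_iter u n" for n
    by (induction n) (auto simp: st_simps assms(2))
  then have "(\<lambda>n. sqrt_iter u n) \<longlonglongrightarrow> st y"
    using isCont_tendsto_compose[OF isCont_st lim] by simp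
  then have sy: "st y = y" using lim LIMSEQ_unique by blast
  have "x * y = y * x" if "x * u = u * x" for x
  proof (rule LIMSEQ_unique)
    show "(\<lambda>n. x * sqrt_iter u n) \<longlonglongrightarrow> x * y" by (intro tendsto_intros lim)
    show "(\<lambda>n. x * sqrt_iter u n) \<longlonglongrightarrow> y * x"
      unfolding sqrt_iter_commute[OF that] by (intro tendsto_intros lim)
  qed
  then show thesis using that sq ny sy by blast
qed

text \<open>Scaling writes \<open>a = t (1 - u)\<close> with \<open>norm u \<le> 1\<close>, which
  reduces to the iteration. The commutation clause stands in for functional calculus in later
  arguments.\<close>

lemma pos_sqrt_exists:
  assumes "pos a"
  obtains c where "pos c" "c * c = a" "\<And>x. x * a = a * x \<Longrightarrow> x * c = c * x"
proof -
  obtain t where t: "norm (t *\<^sub>R 1 - a) \<le> t" and a: "st a = a"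
    using assms unfolding pos_def by blast
  have t0: "t \<ge> 0" using t norm_ge_zero order_trans by blast
  show thesis
  proof (cases "t = 0")
    case True
    then have "a = 0" using t by simp
    then show thesis using assms that[of 0] by simp
  next
    case False
    with t0 have tp: "t > 0" by simp
    define u where "u = 1 - (1/t) *\<^sub>R a"
    have "u = (1/t) *\<^sub>R (t *\<^sub>R 1 - a)" using tp by (simp add: u_def scaleR_diff_right)
    then have "norm u = norm (t *\<^sub>R 1 - a) / t" using tp by simp
    then have "norm u \<le> 1" using t tp by simp
    moreover have "st u = u" by (simp add: u_def st_simps a)
    ultimately obtain y where y: "(1 - y) * (1 - y) = 1 - u" "norm y \<le> 1" "st y = y"
      "\<And>x. x * u = u * x \<Longrightarrow> x * y = y * x"
      using one_minus_sqrt_exists by blast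
    define c where "c = sqrt t *\<^sub>R (1 - y)"
    have "c * c = t *\<^sub>R ((1 - y) * (1 - y))" using t0 by (simp add: c_def)
    then have "c * c = a" unfolding y(1) using tp by (simp add: u_def)
    moreover have "norm (sqrt t *\<^sub>R 1 - c) \<le> sqrt t"
      using y(2) t0 by (simp add: c_def scaleR_diff_right mult_left_le)
    then have "pos c" unfolding pos_def by (auto simp: c_def st_simps y(3))
    moreover have "x * c = c * x" if "x * a = a * x" for x
    proof -
      have "x * u = u * x" using that by (simp add: u_def algebra_simps)
      then show ?thesis using y(4)[of x] by (simp add: c_def algebra_simps)
    qed
    ultimately show thesis using that by blast
  qed
qed

text \<open>With \<open>d = sqrt (norm c ^ 2 - c ^ 2)\<close> the element \<open>u = c + i d\<close> satisfies
  \<open>u* u = norm c ^ 2\<close>, so its imaginary part \<open>d\<close> has norm at most \<open>norm c\<close>.\<close>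
lemma pos_square:
  assumes c: "st c = c"
  shows "pos (c * c)"
proof -
  define t where "t = (norm c)\<^sup>2"
  have "norm (t *\<^sub>R 1 - (t *\<^sub>R 1 - c * c)) \<le> t"
    using norm_st_mult_self[of c] by (simp add: t_def c)
  then have "pos (t *\<^sub>R 1 - c * c)" unfolding pos_def by (auto simp: st_simps c intro!: exI[of _ t])
  then obtain d where d: "pos d" "d * d = t *\<^sub>R 1 - c * c"
    and com: "\<And>x. x * (t *\<^sub>R 1 - c * c) = (t *\<^sub>R 1 - c * c) * x \<Longrightarrow> x * d = d * x"
    using pos_sqrt_exists by blast
  have cd: "c * d = d * c" by (rule com) (simp add: algebra_simps)
  have sd: "st d = d" using d(1) by (rule pos_st)
  define u where "u = c + imag d"
  have "st u * u = t *\<^sub>R 1"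
    by (simp add: u_def st_simps imag_simps c sd cd d(2) algebra_simps)
  then have "(norm u)\<^sup>2 = t"
    using norm_st_mult_self[of u] by (simp add: t_def)
  then have nu: "norm u = norm c" by (simp add: t_def)
  have "2 *\<^sub>R imag d = u - st u" by (simp add: u_def st_simps imag_simps c sd scaleR_2)
  then have "2 * norm d = norm (u - st u)" by (metis norm_imag norm_scaleR abs_numeral)
  also have "\<dots> \<le> norm u + norm (st u)" by (rule norm_triangle_ineq4)
  finally have "norm d \<le> norm c" using nu by simp
  then have "norm (d * d) \<le> t"
    using norm_st_mult_self[of d] by (simp add: sd t_def)
  then show ?thesis unfolding pos_def using d(2) by (auto simp: st_simps c)
qed

lemma pos_one: "pos 1"
  using pos_square[of 1] by simp

text \<open>The roots \<open>f\<close> of \<open>p\<close> and \<open>e\<close> of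
  \<open>- p\<close> commute, so \<open>u = f + i e\<close> has \<open>st u * u = p - p = 0\<close>.
  Hence \<open>u\<close> and its adjoint \<open>f - i e\<close> vanish, and so does
  \<open>f\<close>.\<close>

lemma pos_minus_pos_imp_0:
  assumes "pos p" "pos (- p)"
  shows "p = 0"
proof -
  obtain f where f: "pos f" "f * f = p" "\<And>x. x * p = p * x \<Longrightarrow> x * f = f * x"
    using pos_sqrt_exists[OF assms(1)] by blast
  obtain e where e: "pos e" "e * e = - p" "\<And>x. x * - p = - p * x \<Longrightarrow> x * e = e * x"
    using pos_sqrt_exists[OF assms(2)] by blast
  have "f * p = p * f" by (simp add: f(2)[symmetric] mult.assoc)
  then have fe: "f * e = e * f" by (intro e(3)) simp
  note sa = pos_st[OF f(1)] pos_st[OF e(1)]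
  have "st (f + imag e) * (f + imag e) = 0"
    by (simp add: st_simps imag_simps sa fe f(2) e(2) algebra_simps)
  then have u0: "f + imag e = 0" by (rule st_mult_self_eq_0)
  then have "f - imag e = 0" using sa st_zero by (metis diff_conv_add_uminus st_add st_imag)
  with u0 have "f + f = 0" by (metis add_0 add.assoc add_diff_cancel diff_add_cancel)
  then have "f = 0" by (simp add: scaleR_2[symmetric])
  then show ?thesis using f(2) by simp
qed

text \<open>Up to a factor, the sum is \<open>h^2 + k^2\<close> for the self-adjoint elements
  \<open>h = z + st z\<close> and \<open>k = i (z - st z)\<close>.\<close>

lemma pos_st_mult_add_mult_st: "pos (st z * z + z * st z)"
proof -
  define h where "h = z + st z"
  define k where "k = imag (z - st z)"
  have "pos ((1/2) *\<^sub>R (h * h + k * k))"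
    by (intro pos_scaleR pos_add pos_square)
      (simp_all add: h_def k_def st_simps imag_simps algebra_simps)
  also have "h * h + k * k = 2 *\<^sub>R (st z * z + z * st z)"
    by (simp add: h_def k_def imag_simps algebra_simps scaleR_2)
  finally show ?thesis by simp
qed

text \<open>For \<open>z = x c\<close> both \<open>z z* = - (x x*)^2\<close> and \<open>z* z = - c^4\<close> are nonpositive,
  while their sum is nonnegative.\<close>
lemma st_mult_self_nonpos_imp_0:
  assumes c: "st c = c" and x: "st x * x = - (c * c)"
  shows "x = 0"
proof -
  define z where "z = x * c"
  define b where "b = x * st x"
  have "st z * z = c * (st x * x) * c" by (simp add: z_def st_simps c mult.assoc)
  then have z1: "st z * z = - (c * c * (c * c))" by (simp add: x mult.assoc)
  have "x * (c * c) * st x = - (x * (st x * x) * st x)" by (simp add: x)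
  then have z2: "z * st z = - (b * b)" by (simp add: z_def b_def st_simps c mult.assoc)
  have "pos (b * b)" by (rule pos_square) (simp add: b_def st_simps)
  from pos_add[OF this pos_st_mult_add_mult_st[of z]]
  have "pos (- (c * c * (c * c)))" by (simp add: z1 z2)
  moreover have "pos (c * c * (c * c))" by (rule pos_square) (simp add: st_simps c)
  ultimately have "c * c * (c * c) = 0" by (intro pos_minus_pos_imp_0)
  then have "c * c = 0" by (rule square_eq_0[rotated]) (simp_all add: st_simps c)
  then have "st x * x = 0" using x by simp
  then show ?thesis by (rule st_mult_self_eq_0)
qed

section \<open>Uniqueness of positive roots and of Moore-Penrose inverses\<close>

lemma cpositive_st: "cpositive st S \<Longrightarrow> st S = S"
  by (auto simp: cpositive_def st_mult)

lemma pos_imp_cpositive: "pos a \<Longrightarrow> cpositive st a"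
  by (metis cpositive_def pos_sqrt_exists pos_st)

text \<open>If \<open>C\<close> and \<open>S\<close> commute and have equal squares, then
  \<open>(S - C) S (S - C) = - (S - C) C (S - C)\<close>.\<close>
lemma square_root_unique:
  assumes "cpositive st S" "pos C" "S * C = C * S" "S * S = C * C"
  shows "S = C"
proof -
  obtain y where y: "S = st y * y" using assms(1) by (auto simp: cpositive_def)
  obtain e where e: "pos e" "e * e = C" "\<And>x. x * C = C * x \<Longrightarrow> x * e = e * x"
    using pos_sqrt_exists[OF assms(2)] by blast
  define D where "D = S - C"
  have sD: "st D = D"
    by (simp add: D_def st_simps pos_st[OF assms(2)] cpositive_st[OF assms(1)])
  have De: "D * e = e * D"
    by (rule e(3)) (simp add: D_def algebra_simps assms(3))
  have DSC: "D * (S + C) = 0" by (simp add: D_def algebra_simps assms(3,4))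
  have "D * S * D = - (D * C * D)"
    using arg_cong[OF DSC, of "\<lambda>x. x * D"] by (simp add: algebra_simps eq_neg_iff_add_eq_0)
  also have "D * C * D = (e * D) * (e * D)"
    by (metis De e(2) mult.assoc)
  finally have neg: "st (y * D) * (y * D) = - ((e * D) * (e * D))"
    by (simp add: y st_simps sD mult.assoc)
  \<comment> \<open>\<open>e * D\<close> is self-adjoint because \<open>e\<close> commutes with
    \<open>D\<close>, so \<open>neg\<close> has the shape \<open>st x * x = - c^2\<close>.\<close>
  have "y * D = 0"
    by (rule st_mult_self_nonpos_imp_0[OF _ neg]) (simp add: st_simps sD pos_st[OF e(1)] De)
  then have "D * S * D = 0" "D * C * D = 0"
    using \<open>D * S * D = - (D * C * D)\<close> by (simp_all add: y mult.assoc)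
  then have "D * D * D = 0"
    by (simp add: D_def right_diff_distrib left_diff_distrib)
  then have "(D * D) * (D * D) = 0" by (simp add: mult.assoc[symmetric])
  then have "D * D = 0" by (rule square_eq_0[rotated]) (simp_all add: st_simps sD)
  then have "D = 0" by (rule square_eq_0[OF sD])
  then show ?thesis by (simp add: D_def)
qed

text \<open>The root \<open>C\<close> of \<open>S * S\<close> commutes with everything that commutes
  with \<open>S * S\<close>, in particular with every candidate modulus, so every candidate equals
  \<open>C\<close>.\<close>

lemma cabs_eqI:
  assumes "cpositive st S" "S * S = st T * T"
  shows "cabs st T = S"
proof -
  have "pos (S * S)" by (rule pos_square) (rule cpositive_st[OF assms(1)])
  then obtain C where C: "pos C" "C * C = S * S"
    "\<And>x. x * (S * S) = (S * S) * x \<Longrightarrow> x * C = C * x"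
    using pos_sqrt_exists by blast
  have eq: "S' = C" if "cpositive st S'" "S' * S' = st T * T" for S'
  proof (rule square_root_unique[OF that(1) C(1)])
    show "S' * C = C * S'" by (rule C(3)) (simp add: assms(2) that(2)[symmetric] mult.assoc)
    show "S' * S' = C * C" by (simp add: C(2) assms(2) that(2))
  qed
  show ?thesis
    unfolding cabs_def by (rule the_equality) (use assms eq in auto)
qed

text \<open>For another candidate \<open>Y\<close>, \<open>(T X) (T Y) = T Y\<close>, while the
  adjoint of this product is \<open>T Y T X = T X\<close>; symmetrically on the other side.\<close>

lemma mp_inv_eqI:
  assumes "T * X * T = T" "X * T * X = X" "st (T * X) = T * X" "st (X * T) = X * T"
  shows "mp_inv st T = X"
  unfolding mp_inv_def
proof (rule the_equality)
  fix Y assume Y: "T * Y * T = T \<and> Y * T * Y = Y \<and> st (T * Y) = T * Y \<and> st (Y * T) = Y * T"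
  have "T * Y = st ((T * X) * (T * Y))"
    using Y assms by (metis mult.assoc st_mult)
  also have "\<dots> = T * X"
    using Y assms by (metis mult.assoc st_mult st_st)
  finally have 1: "T * Y = T * X" .
  have "Y * T = st ((Y * T) * (X * T))"
    using Y assms by (metis mult.assoc st_mult)
  also have "\<dots> = X * T"
    using Y assms by (metis mult.assoc st_mult st_st)
  finally show "Y = X" using 1 Y assms(2) by (metis mult.assoc)
qed (use assms in simp)

section \<open>Products and inverses of positive elements\<close>

lemma pos_mult:
  assumes "pos a" "pos b" "a * b = b * a"
  shows "pos (a * b)"
proof -
  obtain c where c: "pos c" "c * c = a" "\<And>x. x * a = a * x \<Longrightarrow> x * c = c * x"
    using pos_sqrt_exists[OF assms(1)] by blast
  obtain d where d: "pos d" "d * d = b" "\<And>x. x * b = b * x \<Longrightarrow> x * d = d * x"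
    using pos_sqrt_exists[OF assms(2)] by blast
  have "c * d = d * c" by (intro d(3) c(3)[symmetric]) (simp add: assms(3))
  then have "a * b = (c * d) * (c * d)" "st (c * d) = c * d"
    using c(2) d(2) pos_st[OF c(1)] pos_st[OF d(1)] by (metis mult.assoc, simp add: st_mult)
  then show ?thesis using pos_square by metis
qed

text \<open>\<open>b = a * b^2\<close> is a product of commuting positive elements.\<close>

lemma pos_inverse:
  assumes "pos a" "a * b = 1" "b * a = 1"
  shows "pos b"
proof -
  have "st b * a = 1" using st_mult[of a b] pos_st[OF assms(1)] assms(2) by simp
  then have "st b = b" using assms(2) by (metis mult.assoc mult_1_left mult_1_right)
  moreover have "a * (b * b) = b * b * a"
    by (metis assms(2,3) mult.assoc mult_1_left mult_1_right)
  ultimately have "pos (a * (b * b))"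
    by (intro pos_mult[OF assms(1)] pos_square)
  then show ?thesis by (simp add: mult.assoc[symmetric] assms(2))
qed

text \<open>\<open>a + 1 = (t + 1) (1 - u)\<close> with \<open>norm u \<le> t / (t + 1) < 1\<close>,
  so the Neumann series applies.\<close>

lemma one_plus_pos_inverse:
  assumes "pos a"
  obtains k where "(a + 1) * k = 1" "k * (a + 1) = 1"
proof -
  obtain t where t: "norm (t *\<^sub>R 1 - a) \<le> t" using assms unfolding pos_def by blast
  have tp: "t + 1 > 0" using order_trans[OF norm_ge_zero t] by simp
  define u where "u = (1/(t+1)) *\<^sub>R (t *\<^sub>R 1 - a)"
  have "norm u = norm (t *\<^sub>R 1 - a) / (t+1)" using tp by (simp add: u_def)
  then have "norm u < 1" using t tp by (simp add: divide_less_eq)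
  then obtain k where k: "(1 - u) * k = 1" "k * (1 - u) = 1" by (rule neumann_inverse)
  have "(t+1) *\<^sub>R u = t *\<^sub>R 1 - a" using tp by (simp add: u_def)
  then have "a + 1 = (t+1) *\<^sub>R (1 - u)" by (simp add: scaleR_diff_right scaleR_add_left)
  then have "(a + 1) * ((1/(t+1)) *\<^sub>R k) = 1" "((1/(t+1)) *\<^sub>R k) * (a + 1) = 1"
    using k tp by simp_all
  then show thesis using that by blast
qed

end

section \<open>The modulus of \<open>Q + st Q - 1\<close> and the matched projection\<close>

theorem theorem3p2:
  fixes sc :: "complex \<Rightarrow> 'a::{banach,real_normed_algebra_1} \<Rightarrow> 'a"
    and st :: "'a \<Rightarrow> 'a"
    and Q :: 'a
  assumes "cstar_alg sc st"
    and "Q * Q = Q"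
  shows "matched_proj st Q =
    (1/4::real) *\<^sub>R (2 * 1 + cabs st (Q + st Q) - cabs st (2 * 1 - (Q + st Q)))"
proof -
  interpret cstar sc st by unfold_locales (rule assms(1))
  define R where "R = st Q"
  define S where "S = Q + R - 1"
  have QQ: "Q * Q = Q" by (rule assms(2))
  have RR: "R * R = R" using QQ by (metis R_def st_mult)
  have stQ: "st Q = R" and stR: "st R = Q" by (simp_all add: R_def)
  have sS: "st S = S" by (simp add: S_def st_simps stQ stR)
  have SS: "S * S = Q * R + R * Q + 1 - Q - R"
    by (simp add: S_def algebra_simps QQ RR)
  obtain W where W: "pos W" "W * W = S * S" "\<And>x. x * (S * S) = S * S * x \<Longrightarrow> x * W = W * x"
    using pos_sqrt_exists[OF pos_square[OF sS]] by blast
  have QSS: "Q * R * Q = Q * (S * S)" and SSQ: "S * S * Q = Q * R * Q"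
    and RSS: "R * Q * R = R * (S * S)" and SSR: "S * S * R = R * Q * R"
    by (simp_all add: SS ring_distribs mult.assoc QQ RR)
      (simp_all add: mult.assoc[symmetric] QQ RR)
  have WQ: "W * Q = Q * W" and WR: "W * R = R * W"
    by (rule W(3)[symmetric], simp add: QSS SSQ RSS SSR)+
  have QRQ: "Q * (R * Q) = Q * (W * W)" and RQR: "R * (Q * R) = R * (W * W)"
    using QSS RSS by (simp_all add: W(2) mult.assoc)

  \<comment> \<open>\<open>N = S^2 - 1\<close> is positive, so \<open>W^2 = N + 1\<close> is
    invertible. Below, \<open>K = W^-2\<close>, \<open>J = W^-1\<close> and
    \<open>L = (W + 1)^-1\<close>.\<close>
  define N where "N = W * W - 1"
  have "N = imag (Q - R) * imag (Q - R)"
    by (simp add: N_def W(2) SS imag_simps algebra_simps QQ RR)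
  moreover have "st (imag (Q - R)) = imag (Q - R)" by (simp add: st_simps imag_simps stQ stR)
  ultimately have posN: "pos N" using pos_square by metis
  obtain K where K: "(N + 1) * K = 1" "K * (N + 1) = 1" using one_plus_pos_inverse[OF posN] .
  obtain L where L: "(W + 1) * L = 1" "L * (W + 1) = 1" using one_plus_pos_inverse[OF W(1)] .
  define J where "J = W * K"
  have K': "W * W * K = 1" "K * (W * W) = 1" using K by (simp_all add: N_def)
  have KW: "W * K = K * W" by (rule inverse_commute[OF K']) (simp add: mult.assoc)
  have J: "W * J = 1" "J * W = 1"
    using K' by (simp add: J_def mult.assoc, simp add: J_def KW mult.assoc)
  have JQ: "J * Q = Q * J" and JR: "J * R = R * J"
    using inverse_commute[OF J] WQ WR by metis+
  have LQ: "L * Q = Q * L" and LR: "L * R = R * L"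
    by (rule inverse_commute[OF L, symmetric]; simp add: algebra_simps WQ WR)+
  have LJ: "L * J = J * L"
    by (rule inverse_commute[OF J]) (rule inverse_commute[OF L, symmetric], simp add: algebra_simps)
  have LW: "L * W = 1 - L" and WL: "W * L = 1 - L"
    using L by (simp_all add: algebra_simps)
  have posJ: "pos J" by (rule pos_inverse[OF W(1) J])
  have posL: "pos L" by (rule pos_inverse[OF pos_add[OF W(1) pos_one] L])
  note sa = pos_st[OF W(1)] pos_st[OF posJ] pos_st[OF posL] stQ stR

  define V where "V = S * J"
  have JS: "J * S = S * J" and WS: "W * S = S * W"
    by (simp_all add: S_def algebra_simps JQ JR WQ WR)
  have sV: "st V = V" by (simp add: V_def st_simps sa sS JS)
  have VV: "V * V = 1"
  proof -
    have "V * V = S * S * (J * J)" unfolding V_def by (metis JS mult.assoc)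
    also have "\<dots> = W * (W * J) * J" by (simp add: W(2)[symmetric] mult.assoc)
    finally show ?thesis by (simp add: J)
  qed
  have WV: "W * V = S" "V * W = S"
    using J WS by (simp_all add: V_def mult.assoc) (metis J(1) mult.assoc mult_1_right)
  \<comment> \<open>\<open>W \<ge> 1\<close> follows from
    \<open>W - 1 = (W + 1)^-1 (W^2 - 1)\<close>, a product of commuting positive elements.\<close>
  have WN: "W - 1 = L * N"
    using L(2) by (simp add: N_def LW algebra_simps mult.assoc[symmetric])
  have "pos (L * N)"
    by (rule pos_mult[OF posL posN], rule inverse_commute[OF L, symmetric])
      (simp add: N_def algebra_simps)
  then have posWm: "pos (W - 1)" by (simp only: WN)
  have pos1V: "pos (1 + U)" if "st U = U" "U * U = 1" for U
  proof -
    have "pos ((1/2) *\<^sub>R ((1 + U) * (1 + U)))"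
      by (intro pos_scaleR pos_square) (simp_all add: st_simps that)
    also have "(1 + U) * (1 + U) = 2 *\<^sub>R (1 + U)" by (simp add: algebra_simps that scaleR_2)
    finally show ?thesis by simp
  qed
  \<comment> \<open>\<open>W + V\<close> and \<open>W - V\<close> are split so that each summand is
    known to be positive.\<close>
  have "pos (W - 1 + (1 + V))" "pos (W - 1 + (1 + - V))"
    by (intro pos_add posWm pos1V; simp add: st_simps sV VV)+
  then have "cpositive st (W + V)" "cpositive st (W - V)"
    by (auto intro: pos_imp_cpositive)
  moreover have "(W + V) * (W + V) = st (Q + R) * (Q + R)"
    "(W - V) * (W - V) = st (2 * 1 - (Q + R)) * (2 * 1 - (Q + R))"
  proof -
    have sum: "Q + R = 1 + S" "2 * 1 - (1 + S) = 1 - S" by (simp_all add: S_def)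
    show "(W + V) * (W + V) = st (Q + R) * (Q + R)"
      "(W - V) * (W - V) = st (2 * 1 - (Q + R)) * (2 * 1 - (Q + R))"
      unfolding sum by (simp_all add: st_simps sS algebra_simps W(2) WV VV)
  qed
  ultimately have cabs: "cabs st (Q + R) = W + V" "cabs st (2 * 1 - (Q + R)) = W - V"
    by (auto intro: cabs_eqI)
  have rhs: "(1/4::real) *\<^sub>R (2 * 1 + cabs st (Q + R) - cabs st (2 * 1 - (Q + R)))
    = (1/2) *\<^sub>R (1 + V)"
  proof -
    have "2 * 1 + (W + V) - (W - V) = 2 *\<^sub>R (1 + V)"
      by (simp add: mult_2 scaleR_2)
    then show ?thesis by (simp only: cabs) simp
  qed

  have push: "\<And>x. W * (Q * x) = Q * (W * x)" "\<And>x. W * (R * x) = R * (W * x)"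
    "\<And>x. J * (Q * x) = Q * (J * x)" "\<And>x. J * (R * x) = R * (J * x)"
    "\<And>x. L * (Q * x) = Q * (L * x)" "\<And>x. L * (R * x) = R * (L * x)"
    "\<And>x. L * (J * x) = J * (L * x)"
    by (simp_all add: mult.assoc[symmetric] WQ WR JQ JR LQ LR LJ)
  have cancel: "\<And>x. W * (J * x) = x" "\<And>x. J * (W * x) = x"
    "\<And>x. Q * (Q * x) = Q * x" "\<And>x. R * (R * x) = R * x"
    by (simp_all add: mult.assoc[symmetric] J QQ RR)
  have triple: "\<And>x. Q * (R * (Q * x)) = Q * (W * (W * x))"
    "\<And>x. R * (Q * (R * x)) = R * (W * (W * x))"
    using QRQ RQR by (metis mult.assoc)+
  have Lx: "\<And>x. L * (W * x) = x - L * x" "\<And>x. W * (L * x) = x - L * x"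
    by (simp_all add: mult.assoc[symmetric] LW WL left_diff_distrib)
  \<comment> \<open>Partial fractions: \<open>1 / (W (W + 1)) = 1 / W - 1 / (W + 1)\<close>.\<close>
  have JL: "J * L = J - L"
    using arg_cong[OF WL, of "\<lambda>x. J * x"] by (simp add: cancel algebra_simps)
  then have JLx: "\<And>x. J * (L * x) = J * x - L * x"
    by (metis mult.assoc left_diff_distrib)
  \<comment> \<open>Normal form: \<open>Q\<close> and \<open>R\<close> to the left, then the factor in \<open>W\<close> as partial fractions.\<close>
  note nf = JL JLx right_diff_distrib mult.assoc push cancel triple QQ RR QRQ RQR WQ WR JQ JR LQ LR LJ J LW WL Lx

  \<comment> \<open>Since \<open>j\<close> commutes with \<open>R\<close>, the root of
    \<open>J\<close> exhibits \<open>A = Q R W^-1\<close> as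
    \<open>st (j * R) * (j * R)\<close>.\<close>
  obtain j where j: "pos j" "j * j = J" "\<And>x. x * J = J * x \<Longrightarrow> x * j = j * x"
    using pos_sqrt_exists[OF posJ] by blast
  define A where "A = Q * R * J"
  have "A = st (j * R) * (j * R)"
    by (simp add: A_def st_simps stR pos_st[OF j(1)] mult.assoc)
       (metis JR j(2) mult.assoc)
  then have "cpositive st A" unfolding cpositive_def by blast
  moreover have "A * A = st R * R" by (simp add: A_def stR nf)
  ultimately have cA: "cabs st R = A" by (rule cabs_eqI)
  have mp: "mp_inv st A = Q * R * J * J * J"
    by (rule mp_inv_eqI) (simp_all add: A_def st_simps sa nf)
  \<comment> \<open>With \<open>P = Q R W^-2\<close> and \<open>A = W P\<close>, the element
    \<open>A + 1\<close> acts as \<open>W + 1\<close> on the range of \<open>P\<close> and as 1 on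
    its complement, so its inverse is \<open>1 - P + L P\<close>.\<close>
  have ci: "cinv (A + 1) = 1 - Q * R * J * J + L * (Q * R * J * J)"
    by (rule cinv_eqI) (simp_all add: A_def ring_distribs nf)
  have QRS: "Q * R + R * Q = W * W + S" by (simp add: W(2) SS) (simp add: S_def)
  \<comment> \<open>The middle factors give \<open>P J L\<close>; then \<open>P Q = Q\<close> and
    \<open>R P = R\<close> reduce the expansion to four terms.\<close>
  have "(A + R) * mp_inv st A * cinv (A + 1) * (A + Q)
    = (Q * R + R * Q + W * (Q + R)) * (J * L)"
    unfolding mp ci by (simp add: A_def ring_distribs nf)
  also have "\<dots> = (W * W + S + W * (S + 1)) * (J * L)"
    by (simp add: QRS S_def)
  also have "\<dots> = (1 + V) * (W * (W + 1) * J * L)"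
  proof -
    \<comment> \<open>As \<open>V W = S\<close>, the terms \<open>S\<close> and \<open>W S\<close>
      are \<open>V W\<close> and \<open>V W^2\<close>.\<close>
    have "W * W + S + W * (S + 1) = (1 + V) * (W * (W + 1))"
      by (simp add: ring_distribs mult.assoc[symmetric] WV WS)
    then show ?thesis by (simp add: mult.assoc)
  qed
  also have "W * (W + 1) * J * L = 1"
    by (simp add: ring_distribs nf)
  finally show ?thesis
    unfolding matched_proj_def R_def[symmetric] rhs cA by simp
qed

end
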